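(* Let $A$ and $B$ be compact operators on a complex Hilbert space $H$, where each of the four pairs $(A+A^*,B+B^* )$, $(A+A^*,B-B^* )$, $(A-A^*,B+B^* )$, $(A-A^*,B-B^* )$ contains at least one nonzero operator. Then $A$ and $B$ commute completely (that is, $A$ commutes with both $B$ and $B^*$) if and only if each of the four sets $\sigma_p(A\pm A^*,B\pm B^* )$, that is, $\sigma_p(A+A^*,B+B^* )$, $\sigma_p(A+A^*,B-B^* )$, $\sigma_p(A-A^*,B+B^* )$, $\sigma_p(A-A^*,B-B^* )$, is the union of countably many, locally finite, complex lines in $\mathbb C^2$.
   Context: For a pair $(A_1,A_2)$ of bounded linear operators on $H$, the joint point spectrum is $$\sigma_p(A_1,A_2)=\{(z_1,z_2)\in\mathbb C^2:\ker(I+z_1A_1+z_2A_2)\neq(0)\},$$ where $I$ is the identity operator on $H$. A complex line in $\mathbb C^2$ is an affine complex subspace of dimension one. "Countably many" includes finitely many. A family of lines is locally finite if every point of $\mathbb C^2$ has a neighborhood meeting only finitely many members of the family. *)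

theory Defs
  imports "HOL-Analysis.Analysis"
begin

(* The underlying real inner product is part of the class, so the library's norm, topology and
   completeness apply as they stand. Positivity of cinner follows from cinner_commute and
   inner_eq_Re_cinner: cinner x x = of_real (inner x x) = of_real ((norm x)^2).
   cinner is linear in its first argument. *)
class complex_inner = real_inner +
  fixes scaleC :: "complex \<Rightarrow> 'a \<Rightarrow> 'a" (infixr "*\<^sub>C" 75)
    and cinner :: "'a \<Rightarrow> 'a \<Rightarrow> complex"
  assumes scaleC_add_right: "c *\<^sub>C (x + y) = c *\<^sub>C x + c *\<^sub>C y"
    and scaleC_add_left: "(c + d) *\<^sub>C x = c *\<^sub>C x + d *\<^sub>C x"
    and scaleC_scaleC: "c *\<^sub>C d *\<^sub>C x = (c * d) *\<^sub>C x"
    and scaleC_of_real: "complex_of_real r *\<^sub>C x = r *\<^sub>R x"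
    and cinner_commute: "cinner x y = cnj (cinner y x)"
    and cinner_add_left: "cinner (x + y) z = cinner x z + cinner y z"
    and cinner_scaleC_left: "cinner (c *\<^sub>C x) y = c * cinner x y"
    and inner_eq_Re_cinner: "x \<bullet> y = Re (cinner x y)"

class chilbert_space = complex_inner + banach

(* The type of bounded linear maps from the library only carries real linearity. *)
definition complex_linear :: "('a::complex_inner \<Rightarrow>\<^sub>L 'a) \<Rightarrow> bool" where
  "complex_linear A \<longleftrightarrow> (\<forall>c x. A (c *\<^sub>C x) = c *\<^sub>C A x)"

definition compact_operator :: "('a::chilbert_space \<Rightarrow>\<^sub>L 'a) \<Rightarrow> bool" where
  "compact_operator A \<longleftrightarrow>
     complex_linear A \<and> (\<forall>S. bounded S \<longrightarrow> compact (closure (blinfun_apply A ` S)))"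

(* Unique by definiteness of cinner; for complex linear A it exists by the Riesz representation
   theorem. *)
definition adj :: "('a::chilbert_space \<Rightarrow>\<^sub>L 'a) \<Rightarrow> ('a \<Rightarrow>\<^sub>L 'a)" where
  "adj A = (THE A' :: 'a \<Rightarrow>\<^sub>L 'a. \<forall>x y. cinner (A x) y = cinner x (A' y))"

definition commute_completely ::
    "('a::chilbert_space \<Rightarrow>\<^sub>L 'a) \<Rightarrow> ('a \<Rightarrow>\<^sub>L 'a) \<Rightarrow> bool" where
  "commute_completely A B \<longleftrightarrow> A o\<^sub>L B = B o\<^sub>L A \<and> A o\<^sub>L adj B = adj B o\<^sub>L A"

definition joint_point_spectrum ::
    "('a::chilbert_space \<Rightarrow>\<^sub>L 'a) \<Rightarrow> ('a \<Rightarrow>\<^sub>L 'a) \<Rightarrow> (complex \<times> complex) set" where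
  "joint_point_spectrum A B =
     {(z1, z2). {x. x + z1 *\<^sub>C A x + z2 *\<^sub>C B x = 0} \<noteq> {0}}"

definition complex_line :: "(complex \<times> complex) set \<Rightarrow> bool" where
  "complex_line L \<longleftrightarrow>
     (\<exists>p1 p2 v1 v2. (v1, v2) \<noteq> (0, 0) \<and> L = range (\<lambda>t. (p1 + t * v1, p2 + t * v2)))"

definition locally_finite_union_of_lines :: "(complex \<times> complex) set \<Rightarrow> bool" where
  "locally_finite_union_of_lines S \<longleftrightarrow>
     (\<exists>\<L>. countable \<L> \<and> (\<forall>L\<in>\<L>. complex_line L) \<and> locally_finite_in euclidean \<L> \<and> S = \<Union>\<L>)"

end

theory Submission
  imports Defs
begin

text \<open>
  \<open>A\<close> and \<open>B\<close> commute completely iff each of \<open>A \<plusminus> A*\<close> commutes with each of \<open>B \<plusminus> B*\<close>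
  (\<open>commute_completely_iff\<close>). Up to a factor \<open>-\<i>\<close> these operators are compact and
  self-adjoint, so the claim reduces to one pair: compact self-adjoint \<open>P\<close> and \<open>Q\<close>, scaled by
  nonzero constants, commute iff their joint point spectrum is a locally finite union of countably
  many lines (\<open>spectrum_lines_iff_commute\<close>).

  If \<open>P\<close> and \<open>Q\<close> commute, every point of the spectrum comes from a joint eigenvector with real
  joint eigenvalue \<open>(l, m)\<close>, and the spectrum is the union of the lines \<open>1 + l z + m w = 0\<close>.
  Compactness allows only finitely many joint eigenvalues away from \<open>(0, 0)\<close>, which gives countability
  and local finiteness (\<open>spectrum_lines_of_commute\<close>).

  If the spectrum is a union of countably many lines, then the eigenvalues \<open>m\<close> of the real
  pencil \<open>P + t Q\<close> lie on countably many lines of the \<open>(t, m)\<close> plane. On a closed invariant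
  subspace, consider the largest eigenvalue as a function of \<open>t\<close>. It takes values on one and the
  same line at three parameters, and by the variational characterization the eigenvector at the
  middle one is then a joint eigenvector (\<open>joint_eigenvector_of_countable_pencil_pos\<close>). So
  every nonzero closed invariant subspace contains a joint eigenvector; hence no nonzero
  vector is orthogonal to all of them, and the commutator vanishes (\<open>commute_of_countable_pencil\<close>).
\<close>

section \<open>Compact symmetric operators and their largest eigenvalues\<close>

text \<open>
  Symmetry refers to the real inner product: for complex linear maps this is the same as symmetry
  for the Hermitian product, and eigenvalues are then real from the start. Compactness is put in
  sequential form so that it passes to sums by taking successive subsequences.
\<close>

definition compact_selfadj :: "('a::real_inner \<Rightarrow> 'a) \<Rightarrow> bool" where
  "compact_selfadj T \<longleftrightarrow> bounded_linear T \<and> (\<forall>x y. T x \<bullet> y = x \<bullet> T y) \<and>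
     (\<forall>x::nat \<Rightarrow> 'a. bounded (range x) \<longrightarrow> (\<exists>r. strict_mono r \<and> convergent (\<lambda>n. T (x (r n)))))"

lemma compact_selfadjD:
  assumes "compact_selfadj T"
  shows "bounded_linear T" "T x \<bullet> y = x \<bullet> T y"
    "bounded (range (f :: nat \<Rightarrow> 'a::real_inner)) \<Longrightarrow> \<exists>r. strict_mono r \<and> convergent (\<lambda>n. T (f (r n)))"
  using assms unfolding compact_selfadj_def by blast+

lemma compact_selfadj_scaleR:
  assumes "compact_selfadj T"
  shows "compact_selfadj (\<lambda>x. c *\<^sub>R T x)"
  unfolding compact_selfadj_def
proof (intro conjI allI impI)
  show "bounded_linear (\<lambda>x. c *\<^sub>R T x)"
    using compact_selfadjD(1)[OF assms] by (rule bounded_linear_const_scaleR)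
  show "(c *\<^sub>R T x) \<bullet> y = x \<bullet> c *\<^sub>R T y" for x y
    using compact_selfadjD(2)[OF assms, of x y] by simp
  fix x :: "nat \<Rightarrow> 'a" assume "bounded (range x)"
  then obtain r l where "strict_mono r" "(\<lambda>n. T (x (r n))) \<longlonglongrightarrow> l"
    using compact_selfadjD(3)[OF assms] unfolding convergent_def by blast
  then show "\<exists>r. strict_mono r \<and> convergent (\<lambda>n. c *\<^sub>R T (x (r n)))"
    using tendsto_scaleR[OF tendsto_const, of _ l sequentially c] unfolding convergent_def by blast
qed

lemma compact_selfadj_add:
  assumes S: "compact_selfadj S" and T: "compact_selfadj T"
  shows "compact_selfadj (\<lambda>x. S x + T x)"
  unfolding compact_selfadj_def
proof (intro conjI allI impI)
  show "bounded_linear (\<lambda>x. S x + T x)"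
    using compact_selfadjD(1)[OF S] compact_selfadjD(1)[OF T] by (rule bounded_linear_add)
  show "(S x + T x) \<bullet> y = x \<bullet> (S y + T y)" for x y
    using compact_selfadjD(2)[OF S, of x y] compact_selfadjD(2)[OF T, of x y]
    by (simp add: inner_add_left inner_add_right)
  fix x :: "nat \<Rightarrow> 'a" assume x: "bounded (range x)"
  then obtain r where r: "strict_mono r" "convergent (\<lambda>n. S (x (r n)))"
    using compact_selfadjD(3)[OF S] by blast
  have "bounded (range (\<lambda>n. x (r n)))"
    using x by (rule bounded_subset) auto
  then obtain q where q: "strict_mono q" "convergent (\<lambda>n. T (x (r (q n))))"
    using compact_selfadjD(3)[OF T] by blast
  have "convergent (\<lambda>n. S (x (r (q n))))"
    using convergent_subseq_convergent[OF r(2) q(1)] by (simp add: o_def)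
  then have "convergent (\<lambda>n. S (x (r (q n))) + T (x (r (q n))))"
    using q(2) by (rule convergent_add)
  then show "\<exists>r. strict_mono r \<and> convergent (\<lambda>n. S (x (r n)) + T (x (r n)))"
    using strict_mono_o[OF r(1) q(1)] by (intro exI[of _ "r \<circ> q"]) (simp add: o_def)
qed

text \<open>
  The form \<open>q x y = m * (x \<bullet> y) - T x \<bullet> y\<close> is positive on \<open>M\<close>, and \<open>q x w = w \<bullet> w\<close>
  for \<open>w = m *\<^sub>R x - T x\<close>. The estimate is the Cauchy--Schwarz inequality for \<open>q\<close>; hence a
  vector that nearly maximizes the Rayleigh quotient is nearly an eigenvector.
\<close>

lemma form_defect_bound:
  assumes T: "compact_selfadj T" and M: "subspace M" and inv: "T ` M \<subseteq> M"
    and C: "C > 0" "\<And>y. \<bar>m\<bar> * norm y + norm (T y) \<le> C * norm y"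
    and ub: "\<And>y. y \<in> M \<Longrightarrow> T y \<bullet> y \<le> m * (y \<bullet> y)" and x: "x \<in> M"
  shows "(norm (m *\<^sub>R x - T x))\<^sup>2 \<le> C * (m * (x \<bullet> x) - T x \<bullet> x)"
proof -
  interpret T: bounded_linear T by (rule compact_selfadjD(1)[OF T])
  note sym = compact_selfadjD(2)[OF T]
  define w where "w = m *\<^sub>R x - T x"
  have w: "w \<in> M"
    unfolding w_def using x inv M by (auto intro!: subspace_diff subspace_scale)
  \<comment> \<open>Minimizing the upper bound for q on the line through x in direction w leads to this s.\<close>
  define s where "s = 1 / C"
  have y: "x - s *\<^sub>R w \<in> M"
    using x w M by (auto intro!: subspace_diff subspace_scale)
  have qw: "m * (w \<bullet> w) - T w \<bullet> w \<le> C * (w \<bullet> w)"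
  proof -
    have "m * (w \<bullet> w) - T w \<bullet> w \<le> \<bar>m\<bar> * (norm w * norm w) + norm (T w) * norm w"
      using Cauchy_Schwarz_ineq2[of "T w" w]
        mult_right_mono[OF abs_ge_self, of "norm w * norm w" m]
      by (simp add: dot_square_norm power2_eq_square)
    also have "\<dots> = (\<bar>m\<bar> * norm w + norm (T w)) * norm w"
      by (simp add: algebra_simps)
    also have "\<dots> \<le> (C * norm w) * norm w"
      using C(2)[of w] by (intro mult_right_mono) auto
    finally show ?thesis by (simp add: dot_square_norm power2_eq_square algebra_simps)
  qed
  have xw: "m * (x \<bullet> w) - T x \<bullet> w = w \<bullet> w"
    by (simp add: w_def inner_diff_left)
  have "0 \<le> m * ((x - s *\<^sub>R w) \<bullet> (x - s *\<^sub>R w)) - T (x - s *\<^sub>R w) \<bullet> (x - s *\<^sub>R w)"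
    using ub[OF y] by simp
  also have "\<dots> = (m * (x \<bullet> x) - T x \<bullet> x) - 2 * s * (m * (x \<bullet> w) - T x \<bullet> w)
      + s\<^sup>2 * (m * (w \<bullet> w) - T w \<bullet> w)"
    using sym[of w x]
    by (simp add: T.diff T.scaleR inner_diff_left inner_diff_right power2_eq_square
        algebra_simps inner_commute)
  also have "\<dots> \<le> (m * (x \<bullet> x) - T x \<bullet> x) - 2 * s * (w \<bullet> w) + s\<^sup>2 * (C * (w \<bullet> w))"
    using mult_left_mono[OF qw, of "s\<^sup>2"] by (simp add: xw)
  also have "\<dots> = (m * (x \<bullet> x) - T x \<bullet> x) - (w \<bullet> w) / C"
    using C(1) by (simp add: s_def power2_eq_square field_simps)
  finally have "(w \<bullet> w) / C \<le> m * (x \<bullet> x) - T x \<bullet> x" by simp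
  then show ?thesis
    using C(1) by (simp add: w_def[symmetric] dot_square_norm field_simps)
qed

lemma form_defect_constant:
  assumes "compact_selfadj T"
  obtains C where "C > 0" "\<And>y. \<bar>m\<bar> * norm y + norm (T y) \<le> C * norm y"
proof -
  interpret T: bounded_linear T by (rule compact_selfadjD(1)[OF assms])
  obtain K where K: "K > 0" "\<And>y. norm (T y) \<le> norm y * K"
    using T.pos_bounded by blast
  show ?thesis
  proof
    show "\<bar>m\<bar> + K > 0" using K(1) by simp
    show "\<bar>m\<bar> * norm y + norm (T y) \<le> (\<bar>m\<bar> + K) * norm y" for y
      using K(2)[of y] by (simp add: algebra_simps)
  qed
qed

lemma form_maximizer_eigenvector:
  assumes T: "compact_selfadj T" and M: "subspace M" and inv: "T ` M \<subseteq> M"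
    and ub: "\<And>y. y \<in> M \<Longrightarrow> T y \<bullet> y \<le> m * (y \<bullet> y)" and x: "x \<in> M"
    and eq: "T x \<bullet> x = m * (x \<bullet> x)"
  shows "T x = m *\<^sub>R x"
proof -
  obtain C where C: "C > 0" "\<And>y. \<bar>m\<bar> * norm y + norm (T y) \<le> C * norm y"
    using form_defect_constant[OF T] by blast
  have "(norm (m *\<^sub>R x - T x))\<^sup>2 \<le> 0"
    using form_defect_bound[OF T M inv C ub x] eq by simp
  then show ?thesis by simp
qed

text \<open>
  A maximizing sequence of unit vectors for the Rayleigh quotient consists of approximate
  eigenvectors. Compactness makes \<open>T\<close> of a subsequence converge, and since the supremum \<open>m\<close> is
  not zero the subsequence itself converges, inside the closed set \<open>M\<close>.
\<close>

lemma top_eigenvalue: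
  assumes T: "compact_selfadj T" and M: "subspace M" "closed M" and inv: "T ` M \<subseteq> M"
    and x0: "x0 \<in> M" "T x0 \<bullet> x0 > 0"
  obtains m x where "m > 0" "x \<in> M" "norm x = 1" "T x = m *\<^sub>R x"
    "\<And>y. y \<in> M \<Longrightarrow> T y \<bullet> y \<le> m * (y \<bullet> y)"
proof -
  interpret T: bounded_linear T by (rule compact_selfadjD(1)[OF T])
  define S where "S = {T y \<bullet> y |y. y \<in> M \<and> norm y = 1}"
  define m where "m = Sup S"
  obtain K where K: "K > 0" "\<And>y. norm (T y) \<le> norm y * K"
    using T.pos_bounded by blast
  have "s \<le> K" if "s \<in> S" for s
  proof -
    obtain y where y: "s = T y \<bullet> y" "norm y = 1" using \<open>s \<in> S\<close> unfolding S_def by blast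
    show ?thesis using Cauchy_Schwarz_ineq2[of "T y" y] K(2)[of y] y by simp
  qed
  then have bdd: "bdd_above S" by (auto simp: bdd_above_def)
  have normalized: "(T y \<bullet> y) / (y \<bullet> y) \<in> S" if "y \<in> M" "y \<noteq> 0" for y
  proof -
    let ?u = "(1 / norm y) *\<^sub>R y"
    have "T ?u \<bullet> ?u = (T y \<bullet> y) / (y \<bullet> y)"
      using that by (simp add: T.scaleR dot_square_norm power2_eq_square)
    moreover have "?u \<in> M" "norm ?u = 1"
      using that M by (auto intro: subspace_scale)
    then have "T ?u \<bullet> ?u \<in> S" unfolding S_def by blast
    ultimately show ?thesis by simp
  qed
  have x0': "x0 \<noteq> 0" using x0(2) by auto
  then have "x0 \<bullet> x0 > 0" by simp
  then have "0 < (T x0 \<bullet> x0) / (x0 \<bullet> x0)" using x0 by simp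
  also have "\<dots> \<le> m"
    unfolding m_def using bdd normalized[OF x0(1) x0'] by (rule cSup_upper[rotated])
  finally have m: "m > 0" .
  have ub: "T y \<bullet> y \<le> m * (y \<bullet> y)" if y: "y \<in> M" for y
  proof (cases "y = 0")
    case False
    then have "(T y \<bullet> y) / (y \<bullet> y) \<le> m"
      unfolding m_def using bdd normalized[OF y] by (intro cSup_upper) auto
    then show ?thesis using False by (simp add: field_simps)
  qed (simp add: T.zero)
  obtain C where C: "C > 0" "\<And>y. \<bar>m\<bar> * norm y + norm (T y) \<le> C * norm y"
    using form_defect_constant[OF T] by blast
  have "\<exists>y. y \<in> M \<and> norm y = 1 \<and> m - 1 / Suc n < T y \<bullet> y" for n
  proof -
    have "m - 1 / Suc n < Sup S" by (simp add: m_def)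
    then obtain s where "s \<in> S" "m - 1 / Suc n < s"
      using less_cSup_iff[OF _ bdd] normalized[OF x0(1) x0'] by blast
    then show ?thesis by (auto simp: S_def)
  qed
  then obtain u where u: "\<And>n. u n \<in> M" "\<And>n. norm (u n) = 1"
      "\<And>n. m - 1 / Suc n < T (u n) \<bullet> u n"
    by metis
  have defect: "(\<lambda>n. norm (m *\<^sub>R u n - T (u n))) \<longlonglongrightarrow> 0"
  proof -
    have bound: "(norm (m *\<^sub>R u n - T (u n)))\<^sup>2 \<le> C * (1 / Suc n)" for n
    proof -
      have "(norm (m *\<^sub>R u n - T (u n)))\<^sup>2 \<le> C * (m * (u n \<bullet> u n) - T (u n) \<bullet> u n)"
        by (rule form_defect_bound[OF T M(1) inv C ub u(1)])
      also have "\<dots> \<le> C * (1 / Suc n)"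
        using u(2,3)[of n] C(1) by (intro mult_left_mono) (auto simp: dot_square_norm)
      finally show ?thesis .
    qed
    have "(\<lambda>n. C * (1 / Suc n)) \<longlonglongrightarrow> C * 0"
      by (intro tendsto_mult tendsto_const) (rule LIMSEQ_Suc[OF lim_1_over_n])
    then have upper: "(\<lambda>n. C * (1 / Suc n)) \<longlonglongrightarrow> 0" by simp
    have "(\<lambda>n. (norm (m *\<^sub>R u n - T (u n)))\<^sup>2) \<longlonglongrightarrow> 0"
      by (rule tendsto_sandwich[OF _ _ tendsto_const upper])
        (intro always_eventually allI bound zero_le_power2)+
    from tendsto_real_sqrt[OF this] show ?thesis by simp
  qed
  have "bounded (range u)" using u(2) by (auto simp: bounded_iff)
  then obtain r where r: "strict_mono r" "convergent (\<lambda>n. T (u (r n)))"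
    using compact_selfadjD(3)[OF T] by blast
  then obtain l where l: "(\<lambda>n. T (u (r n))) \<longlonglongrightarrow> l" by (auto simp: convergent_def)
  have "(\<lambda>n. m *\<^sub>R u (r n) - T (u (r n))) \<longlonglongrightarrow> 0"
    using LIMSEQ_subseq_LIMSEQ[OF defect r(1)] by (simp add: tendsto_norm_zero_iff o_def)
  from tendsto_add[OF this l] have "(\<lambda>n. m *\<^sub>R u (r n)) \<longlonglongrightarrow> l" by simp
  from tendsto_scaleR[OF tendsto_const[of "1/m"] this]
  have lim: "(\<lambda>n. u (r n)) \<longlonglongrightarrow> (1/m) *\<^sub>R l" using m by simp
  define x where "x = (1/m) *\<^sub>R l"
  have x: "x \<in> M"
    using closed_sequentially[OF M(2) _ lim] u(1) by (simp add: x_def)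
  have "norm x = 1"
    using tendsto_norm[OF lim] unfolding u(2) x_def[symmetric] by (simp add: LIMSEQ_const_iff)
  moreover have "T x = m *\<^sub>R x"
  proof -
    have "(\<lambda>n. T (u (r n))) \<longlonglongrightarrow> T x"
      unfolding x_def by (rule T.tendsto[OF lim])
    with l have "T x = l" by (rule LIMSEQ_unique[symmetric])
    then show ?thesis using m by (simp add: x_def)
  qed
  ultimately show ?thesis using that m x ub by blast
qed

lemma form_zero_imp_zero:
  assumes T: "compact_selfadj T" and M: "subspace M" and inv: "T ` M \<subseteq> M"
    and zero: "\<And>y. y \<in> M \<Longrightarrow> T y \<bullet> y = 0" and x: "x \<in> M"
  shows "T x = 0"
  using form_maximizer_eigenvector[OF T M inv, of 0 x] zero x by simp

lemma eigenvector_in_subspace: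
  assumes T: "compact_selfadj T" and M: "subspace M" "closed M" "M \<noteq> {0}" and inv: "T ` M \<subseteq> M"
  obtains x l where "x \<in> M" "x \<noteq> 0" "T x = l *\<^sub>R x"
proof -
  obtain z where z: "z \<in> M" "z \<noteq> 0" using M(1,3) subspace_0 by blast
  consider y where "y \<in> M" "T y \<bullet> y > 0" | y where "y \<in> M" "T y \<bullet> y < 0"
    | "\<And>y. y \<in> M \<Longrightarrow> T y \<bullet> y = 0"
    by (meson linorder_less_linear)
  then show ?thesis
  proof cases
    case 1
    show ?thesis
    proof (rule top_eigenvalue[OF T M(1,2) inv 1])
      fix m x assume "x \<in> M" "norm x = 1" "T x = m *\<^sub>R x"
      then show ?thesis using that[of x m] by fastforce
    qed
  next
    case 2
    have neg: "compact_selfadj (\<lambda>x. - T x)"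
      using compact_selfadj_scaleR[OF T, of "-1"] by simp
    have inv': "(\<lambda>x. - T x) ` M \<subseteq> M" using inv M(1) by (auto intro!: subspace_neg)
    have pos: "- T y \<bullet> y > 0" using 2 by simp
    show ?thesis
    proof (rule top_eigenvalue[OF neg M(1,2) inv' 2(1) pos])
      fix m x assume x: "x \<in> M" "norm x = 1" "- T x = m *\<^sub>R x"
      then have "T x = (- m) *\<^sub>R x" by (metis minus_minus scaleR_left.minus)
      then show ?thesis using that[of x "-m"] x(1,2) by fastforce
    qed
  next
    case 3
    then show ?thesis using that[of z 0] form_zero_imp_zero[OF T M(1) inv] z by simp
  qed
qed

section \<open>Pencils whose eigenvalues lie on countably many lines\<close>

text \<open>
  The pair \<open>(a, b)\<close> stands for the line \<open>m = a + t * b\<close> in the plane of the parameter \<open>t\<close> of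
  the pencil \<open>P + t Q\<close> and its eigenvalue \<open>m\<close>. The eigenvalue \<open>m\<close> at parameter \<open>t\<close> corresponds
  to the point \<open>(-1/m, -t/m)\<close> of the joint point spectrum of \<open>(P, Q)\<close>, and lines go to lines.
\<close>

definition pencil_eigenvalues_on ::
    "('a::real_vector \<Rightarrow> 'a) \<Rightarrow> ('a \<Rightarrow> 'a) \<Rightarrow> (real \<times> real) set \<Rightarrow> bool" where
  "pencil_eigenvalues_on P Q F \<longleftrightarrow>
     (\<forall>m t x. m \<noteq> 0 \<longrightarrow> x \<noteq> 0 \<longrightarrow> P x + t *\<^sub>R Q x = m *\<^sub>R x \<longrightarrow> (\<exists>(a, b)\<in>F. m = a + t * b))"

text \<open>
  For small \<open>t > 0\<close> the largest eigenvalue \<open>m t\<close> of the pencil \<open>P + t Q\<close> on \<open>M\<close> exists. Each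
  point \<open>(t, m t)\<close> lies on one of countably many lines, so three of them lie on the same line.
  The Rayleigh quotient of the eigenvector \<open>x\<close> at the middle parameter is affine in \<open>t\<close>, bounded
  by \<open>m\<close> at the outer parameters and equal to it in the middle; so it equals \<open>m\<close> at all three.
  Thus \<open>x\<close> maximizes the quotient, and is an eigenvector, for two different parameters, which makes
  it an eigenvector of both operators.
\<close>

lemma joint_eigenvector_of_countable_pencil_pos:
  assumes P: "compact_selfadj P" and Q: "compact_selfadj Q"
    and M: "subspace M" "closed M" and inv: "P ` M \<subseteq> M" "Q ` M \<subseteq> M"
    and F: "countable F" "pencil_eigenvalues_on P Q F"
    and x0: "x0 \<in> M" "P x0 \<bullet> x0 > 0"
  obtains x a b where "x \<in> M" "x \<noteq> 0" "P x = a *\<^sub>R x" "Q x = b *\<^sub>R x"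
proof -
  have pencil: "compact_selfadj (\<lambda>x. P x + t *\<^sub>R Q x)" for t
    by (intro compact_selfadj_add compact_selfadj_scaleR P Q)
  have inv_pencil: "(\<lambda>x. P x + t *\<^sub>R Q x) ` M \<subseteq> M" for t
    using inv M(1) by (auto intro!: subspace_add subspace_scale)
  \<comment> \<open>For t below this bound the form of the pencil is still positive at x0.\<close>
  define e where "e = (P x0 \<bullet> x0) / (1 + \<bar>Q x0 \<bullet> x0\<bar>)"
  have e: "e > 0" using x0 by (simp add: e_def add_pos_nonneg)
  have "\<exists>m x. m > 0 \<and> x \<in> M \<and> norm x = 1 \<and> P x + t *\<^sub>R Q x = m *\<^sub>R x \<and>
      (\<forall>y\<in>M. (P y + t *\<^sub>R Q y) \<bullet> y \<le> m * (y \<bullet> y))" if t: "t \<in> {0<..<e}" for t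
  proof -
    have "t * \<bar>Q x0 \<bullet> x0\<bar> \<le> e * \<bar>Q x0 \<bullet> x0\<bar>"
      using t by (intro mult_right_mono) auto
    also have "\<dots> < P x0 \<bullet> x0"
      using e x0(2) unfolding e_def by (simp add: field_simps add_pos_nonneg)
    finally have "t * \<bar>Q x0 \<bullet> x0\<bar> < P x0 \<bullet> x0" .
    moreover have "- (t * \<bar>Q x0 \<bullet> x0\<bar>) \<le> t * (Q x0 \<bullet> x0)"
    proof -
      have "t * (- \<bar>Q x0 \<bullet> x0\<bar>) \<le> t * (Q x0 \<bullet> x0)"
        using t by (intro mult_left_mono) auto
      then show ?thesis by simp
    qed
    ultimately have "(P x0 + t *\<^sub>R Q x0) \<bullet> x0 > 0" by (simp add: inner_add_left)
    from top_eigenvalue[OF pencil M inv_pencil x0(1) this] show ?thesis by metis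
  qed
  then obtain m v where mv: "\<And>t. t \<in> {0<..<e} \<Longrightarrow> m t > 0 \<and> v t \<in> M \<and> norm (v t) = 1 \<and>
      P (v t) + t *\<^sub>R Q (v t) = m t *\<^sub>R v t \<and>
      (\<forall>y\<in>M. (P y + t *\<^sub>R Q y) \<bullet> y \<le> m t * (y \<bullet> y))"
    by metis
  have "\<exists>p. p \<in> F \<and> m t = fst p + t * snd p" if t: "t \<in> {0<..<e}" for t
  proof -
    have "m t \<noteq> 0" "v t \<noteq> 0" using mv[OF t] by auto
    then obtain a b where "(a, b) \<in> F" "m t = a + t * b"
      using F(2) mv[OF t] unfolding pencil_eigenvalues_on_def by blast
    then show ?thesis by (intro exI[of _ "(a, b)"]) simp
  qed
  then obtain f where f: "\<And>t. t \<in> {0<..<e} \<Longrightarrow> f t \<in> F \<and> m t = fst (f t) + t * snd (f t)"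
    by metis
  have "\<exists>p\<in>F. infinite {t \<in> {0<..<e}. f t = p}"
  proof (rule ccontr)
    assume "\<not> ?thesis"
    then have "countable (\<Union>p\<in>F. {t \<in> {0<..<e}. f t = p})"
      using F(1) by (intro countable_UN) (auto intro: countable_finite)
    moreover have "(\<Union>p\<in>F. {t \<in> {0<..<e}. f t = p}) = {0<..<e}" using f by blast
    ultimately show False using uncountable_open_interval[of 0 e] e by simp
  qed
  then obtain a b where inf: "infinite {t \<in> {0<..<e}. f t = (a, b)}" by auto
  obtain t1 t2 t3 where t: "t1 < t2" "t2 < t3"
    and ts: "t1 \<in> {t \<in> {0<..<e}. f t = (a, b)}" "t2 \<in> {t \<in> {0<..<e}. f t = (a, b)}"
      "t3 \<in> {t \<in> {0<..<e}. f t = (a, b)}"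
  proof -
    obtain G where G: "finite G" "card G = 3" "G \<subseteq> {t \<in> {0<..<e}. f t = (a, b)}"
      using infinite_arbitrarily_large[OF inf, of 3] by blast
    obtain x y z where xyz: "G = {x, y, z}" "x \<noteq> y" "x \<noteq> z" "y \<noteq> z"
      using G(2) card_3_iff by metis
    show ?thesis
      by (rule linorder_cases[of x y]; rule linorder_cases[of x z]; rule linorder_cases[of y z])
        (use that G(3) xyz in auto)
  qed
  have mt: "m t1 = a + t1 * b" "m t2 = a + t2 * b" "m t3 = a + t3 * b"
    using f ts by auto
  define x where "x = v t2"
  have x: "x \<in> M" "norm x = 1" "P x + t2 *\<^sub>R Q x = m t2 *\<^sub>R x"
    using mv[of t2] ts by (auto simp: x_def)
  define p where "p = P x \<bullet> x"
  define q where "q = Q x \<bullet> x"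
  have xx: "x \<bullet> x = 1" using x by (simp add: dot_square_norm)
  have "(P x + t2 *\<^sub>R Q x) \<bullet> x = m t2" by (simp add: x xx)
  then have mid: "p + t2 * q = a + t2 * b" by (simp add: p_def q_def inner_add_left mt)
  have le: "p + t1 * q \<le> a + t1 * b" "p + t3 * q \<le> a + t3 * b"
    using mv[of t1] mv[of t3] ts x(1) xx mt
    by (auto simp: p_def q_def inner_add_left dest!: bspec[of M _ x])
  have "q = b"
  proof (rule antisym)
    have "(t3 - t2) * q \<le> (t3 - t2) * b" using mid le by (simp add: algebra_simps)
    then show "q \<le> b" using t by simp
    have "(t2 - t1) * b \<le> (t2 - t1) * q" using mid le by (simp add: algebra_simps)
    then show "b \<le> q" using t by simp
  qed
  with mid have "p = a" by simp
  have e1: "P x + t1 *\<^sub>R Q x = (a + t1 * b) *\<^sub>R x"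
  proof (rule form_maximizer_eigenvector[OF pencil M(1) inv_pencil _ x(1)])
    show "(P y + t1 *\<^sub>R Q y) \<bullet> y \<le> (a + t1 * b) * (y \<bullet> y)" if "y \<in> M" for y
      using mv[of t1] ts that mt by auto
    show "(P x + t1 *\<^sub>R Q x) \<bullet> x = (a + t1 * b) * (x \<bullet> x)"
      using \<open>p = a\<close> \<open>q = b\<close> by (simp add: inner_add_left xx p_def q_def)
  qed
  have e2: "P x + t2 *\<^sub>R Q x = (a + t2 * b) *\<^sub>R x" using x mt by simp
  have "(t2 - t1) *\<^sub>R Q x = (P x + t2 *\<^sub>R Q x) - (P x + t1 *\<^sub>R Q x)"
    by (simp add: algebra_simps)
  also have "\<dots> = (t2 - t1) *\<^sub>R b *\<^sub>R x" unfolding e1 e2 by (simp add: algebra_simps)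
  finally have Qx: "Q x = b *\<^sub>R x" using t by (simp del: scaleR_scaleR)
  have "P x = a *\<^sub>R x" using e1 by (simp add: Qx algebra_simps)
  then show ?thesis using that[of x a b] x Qx by fastforce
qed

text \<open>
  If the form of \<open>P\<close> takes a positive value, the previous lemma applies; if it takes a negative
  one, it applies to \<open>- P\<close> and \<open>- Q\<close>; otherwise \<open>P\<close> vanishes on \<open>M\<close>, and every
  eigenvector of \<open>Q\<close> will do.
\<close>

lemma joint_eigenvector_of_countable_pencil:
  assumes P: "compact_selfadj P" and Q: "compact_selfadj Q"
    and M: "subspace M" "closed M" "M \<noteq> {0}" and inv: "P ` M \<subseteq> M" "Q ` M \<subseteq> M"
    and F: "countable F" "pencil_eigenvalues_on P Q F"
  obtains x a b where "x \<in> M" "x \<noteq> 0" "P x = a *\<^sub>R x" "Q x = b *\<^sub>R x"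
proof -
  consider y where "y \<in> M" "P y \<bullet> y > 0" | y where "y \<in> M" "P y \<bullet> y < 0"
    | "\<And>y. y \<in> M \<Longrightarrow> P y \<bullet> y = 0"
    by (meson linorder_less_linear)
  then show ?thesis
  proof cases
    case 1
    from joint_eigenvector_of_countable_pencil_pos[OF P Q M(1,2) inv F this] show ?thesis
      using that by blast
  next
    case 2
    let ?P = "\<lambda>x. - P x" and ?Q = "\<lambda>x. - Q x" and ?F = "(\<lambda>(a, b). (- a, - b)) ` F"
    have neg: "compact_selfadj ?P" "compact_selfadj ?Q"
      using compact_selfadj_scaleR[OF P, of "-1"] compact_selfadj_scaleR[OF Q, of "-1"] by auto
    have inv': "?P ` M \<subseteq> M" "?Q ` M \<subseteq> M" using inv M(1) by (auto intro!: subspace_neg)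
    have F': "pencil_eigenvalues_on ?P ?Q ?F"
      unfolding pencil_eigenvalues_on_def
    proof (intro allI impI)
      fix m t x
      assume ev: "m \<noteq> 0" "x \<noteq> 0" "?P x + t *\<^sub>R ?Q x = m *\<^sub>R x"
      have "P x + t *\<^sub>R Q x = - (?P x + t *\<^sub>R ?Q x)" by simp
      also have "\<dots> = (- m) *\<^sub>R x" unfolding ev(3) by simp
      finally have "P x + t *\<^sub>R Q x = (- m) *\<^sub>R x" .
      moreover have "- m \<noteq> 0" using ev(1) by simp
      ultimately obtain a b where ab: "(a, b) \<in> F" "- m = a + t * b"
        using F(2) ev(2) unfolding pencil_eigenvalues_on_def by blast
      then have "(- a, - b) \<in> ?F" "m = - a + t * - b" by (force, simp)
      then show "\<exists>(a, b)\<in>?F. m = a + t * b" by blast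
    qed
    have "?P y \<bullet> y > 0" using 2 by simp
    from joint_eigenvector_of_countable_pencil_pos
        [OF neg M(1,2) inv' countable_image[OF F(1)] F' 2(1) this]
    obtain x a b where "x \<in> M" "x \<noteq> 0" "- P x = a *\<^sub>R x" "- Q x = b *\<^sub>R x" by metis
    then show ?thesis using that[of x "-a" "-b"] by (metis minus_minus scaleR_left.minus)
  next
    case 3
    obtain x l where "x \<in> M" "x \<noteq> 0" "Q x = l *\<^sub>R x"
      using eigenvector_in_subspace[OF Q M inv(2)] by blast
    then show ?thesis using that[of x 0 l] form_zero_imp_zero[OF P M(1) inv(1) 3] by simp
  qed
qed

text \<open>
  The vectors orthogonal to all joint eigenvectors form a closed invariant subspace without a joint
  eigenvector, which must be zero. The commutator of symmetric operators is antisymmetric and kills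
  joint eigenvectors, so its range lies in that subspace.
\<close>

lemma commute_of_countable_pencil:
  assumes P: "compact_selfadj P" and Q: "compact_selfadj Q" and
    F: "countable F" "pencil_eigenvalues_on P Q F"
  shows "P (Q x) = Q (P x)"
proof -
  interpret P: bounded_linear P by (rule compact_selfadjD(1)[OF P])
  interpret Q: bounded_linear Q by (rule compact_selfadjD(1)[OF Q])
  note sym = compact_selfadjD(2)[OF P] compact_selfadjD(2)[OF Q]
  define J where "J = {v. \<exists>a b. P v = a *\<^sub>R v \<and> Q v = b *\<^sub>R v}"
  define M where "M = {x. \<forall>v\<in>J. x \<bullet> v = 0}"
  have M: "subspace M"
    by (auto simp: M_def subspace_def inner_add_left)
  have "closed M"
  proof -
    have "M = (\<Inter>v\<in>J. {x. x \<bullet> v = 0})" by (auto simp: M_def)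
    then show ?thesis
      by (auto intro!: closed_INT closed_Collect_eq continuous_intros)
  qed
  have inv: "P ` M \<subseteq> M" "Q ` M \<subseteq> M"
    by (auto simp: M_def J_def sym)
  have "M = {0}"
  proof (rule ccontr)
    assume "M \<noteq> {0}"
    from joint_eigenvector_of_countable_pencil[OF P Q M \<open>closed M\<close> this inv F]
    obtain x a b where "x \<in> M" "x \<noteq> 0" "P x = a *\<^sub>R x" "Q x = b *\<^sub>R x" by metis
    then have "x \<bullet> x = 0" unfolding M_def J_def by blast
    then show False using \<open>x \<noteq> 0\<close> by simp
  qed
  have "(P (Q x) - Q (P x)) \<bullet> v = 0" if "v \<in> J" for v
  proof -
    obtain a b where v: "P v = a *\<^sub>R v" "Q v = b *\<^sub>R v" using \<open>v \<in> J\<close> by (auto simp: J_def)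
    show ?thesis by (simp add: inner_diff_left sym v P.scaleR Q.scaleR)
  qed
  then have "P (Q x) - Q (P x) \<in> M" by (simp add: M_def)
  with \<open>M = {0}\<close> show ?thesis by simp
qed

section \<open>Joint eigenvalues away from zero\<close>

text \<open>
  Joint eigenvectors for different pairs are orthogonal, because \<open>P\<close> or \<open>Q\<close> separates them. For
  infinitely many pairs with \<open>\<bar>l\<bar> \<ge> r\<close>, the images of unit eigenvectors under \<open>P\<close> would be
  at mutual distance at least \<open>r\<close>.
\<close>

lemma finite_large_joint_eigenvalues:
  assumes P: "compact_selfadj P" and Q: "compact_selfadj Q" and r: "r > 0"
  shows "finite {(l, m). \<bar>l\<bar> \<ge> r \<and> (\<exists>x\<noteq>0. P x = l *\<^sub>R x \<and> Q x = m *\<^sub>R x)}" (is "finite ?J")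
proof (rule ccontr)
  assume "infinite ?J"
  from infinite_countable_subset[OF this]
  obtain f :: "nat \<Rightarrow> real \<times> real" where f: "inj f" "range f \<subseteq> ?J"
    by (elim exE conjE)
  interpret P: bounded_linear P by (rule compact_selfadjD(1)[OF P])
  interpret Q: bounded_linear Q by (rule compact_selfadjD(1)[OF Q])
  note sym = compact_selfadjD(2)[OF P] compact_selfadjD(2)[OF Q]
  have fJ: "f n \<in> ?J" for n by (rule subsetD[OF f(2) rangeI])
  have "\<exists>x. norm x = 1 \<and> P x = fst (f n) *\<^sub>R x \<and> Q x = snd (f n) *\<^sub>R x" for n
  proof -
    obtain x where "x \<noteq> 0" "P x = fst (f n) *\<^sub>R x" "Q x = snd (f n) *\<^sub>R x"
      using fJ[of n] by (auto simp: case_prod_beta)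
    then show ?thesis
      by (intro exI[of _ "(1 / norm x) *\<^sub>R x"]) (simp add: P.scaleR Q.scaleR)
  qed
  then obtain u where u: "\<And>n. norm (u n) = 1" "\<And>n. P (u n) = fst (f n) *\<^sub>R u n"
      "\<And>n. Q (u n) = snd (f n) *\<^sub>R u n"
    by metis
  have orth: "u i \<bullet> u j = 0" if "i \<noteq> j" for i j
  proof -
    have "f i \<noteq> f j" using f(1) that by (auto dest: injD)
    moreover have "(fst (f i) - fst (f j)) * (u i \<bullet> u j) = 0"
      using sym(1)[of "u i" "u j"] by (simp add: u algebra_simps)
    moreover have "(snd (f i) - snd (f j)) * (u i \<bullet> u j) = 0"
      using sym(2)[of "u i" "u j"] by (simp add: u algebra_simps)
    ultimately show ?thesis by (auto simp: prod_eq_iff)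
  qed
  have unit: "u n \<bullet> u n = 1" for n using u(1)[of n] by (simp add: dot_square_norm)
  have large: "r\<^sup>2 \<le> (fst (f n))\<^sup>2" for n
  proof -
    have "\<bar>r\<bar> \<le> \<bar>fst (f n)\<bar>" using fJ[of n] r by (simp add: case_prod_beta)
    then show ?thesis by (rule abs_le_square_iff[THEN iffD1])
  qed
  have sep: "r \<le> norm (P (u i) - P (u j))" if "i \<noteq> j" for i j
  proof -
    have "(norm (P (u i) - P (u j)))\<^sup>2 = (fst (f i))\<^sup>2 + (fst (f j))\<^sup>2"
      using orth[OF that] orth[OF that[symmetric]] unit
      by (simp add: u(2) power2_norm_eq_inner inner_diff_left inner_diff_right)
        (simp add: power2_eq_square)
    then have "r\<^sup>2 \<le> (norm (P (u i) - P (u j)))\<^sup>2"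
      using large[of i] zero_le_power2[of "fst (f j)"] by linarith
    then show ?thesis by (rule power2_le_imp_le) simp
  qed
  have "bounded (range u)" using u(1) by (auto simp: bounded_iff)
  then obtain s where s: "strict_mono s" "convergent (\<lambda>n. P (u (s n)))"
    using compact_selfadjD(3)[OF P] by blast
  from convergent_Cauchy[OF s(2)] obtain N where
    N: "\<And>i j. i \<ge> N \<Longrightarrow> j \<ge> N \<Longrightarrow> norm (P (u (s i)) - P (u (s j))) < r"
    using CauchyD[OF _ r] by blast
  have "s N \<noteq> s (Suc N)" using strict_monoD[OF s(1), of N "Suc N"] by simp
  from sep[OF this] N[of N "Suc N"] show False by simp
qed

section \<open>Complex scalars and complex lines\<close>

lemma scaleC_one [simp]: "1 *\<^sub>C x = (x::'a::complex_inner)"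
  using scaleC_of_real[of 1 x] by simp

lemma scaleC_zero_left [simp]: "0 *\<^sub>C x = (0::'a::complex_inner)"
  using scaleC_of_real[of 0 x] by simp

lemma scaleC_zero_right [simp]: "c *\<^sub>C (0::'a::complex_inner) = 0"
  using scaleC_add_right[of c 0 0] by simp

lemma scaleC_minus_right: "c *\<^sub>C (- x) = - (c *\<^sub>C (x::'a::complex_inner))"
  using scaleC_add_right[of c x "- x"] by (simp add: eq_neg_iff_add_eq_0 add.commute)

lemma scaleC_diff_right: "c *\<^sub>C (x - y) = c *\<^sub>C x - c *\<^sub>C (y::'a::complex_inner)"
  using scaleC_add_right[of c x "- y"] by (simp add: scaleC_minus_right)

lemma scaleC_eq_0_iff [simp]: "c *\<^sub>C x = 0 \<longleftrightarrow> c = 0 \<or> x = (0::'a::complex_inner)"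
proof
  assume "c *\<^sub>C x = 0"
  then have "(inverse c * c) *\<^sub>C x = 0"
    by (metis scaleC_scaleC scaleC_zero_right)
  then show "c = 0 \<or> x = 0" by (cases "c = 0") auto
qed auto

lemma scaleC_scaleR: "c *\<^sub>C (r *\<^sub>R x) = (c * of_real r) *\<^sub>C (x::'a::complex_inner)"
  by (metis scaleC_of_real scaleC_scaleC)

lemma cinner_scaleC_right: "cinner x (c *\<^sub>C y) = cnj c * cinner x (y::'a::complex_inner)"
  by (metis cinner_commute cinner_scaleC_left complex_cnj_mult)

text \<open>
  The Hermitian product is determined by the real one, so statements about it reduce to the real
  inner product and complex linearity.
\<close>

lemma cinner_eq_inner: "cinner x (y::'a::complex_inner) = Complex (x \<bullet> y) (x \<bullet> (\<i> *\<^sub>C y))"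
  by (simp add: complex_eq_iff inner_eq_Re_cinner cinner_scaleC_right)

lemma inner_scaleC_right: "x \<bullet> (c *\<^sub>C y) = (cnj c *\<^sub>C x) \<bullet> (y::'a::complex_inner)"
  by (simp add: inner_eq_Re_cinner cinner_scaleC_left cinner_scaleC_right)

lemma norm_scaleC: "norm (c *\<^sub>C (x::'a::complex_inner)) = cmod c * norm x"
proof -
  have "(c *\<^sub>C x) \<bullet> (c *\<^sub>C x) = Re ((c * cnj c) * cinner x x)"
    by (simp add: inner_eq_Re_cinner cinner_scaleC_left cinner_scaleC_right mult.assoc mult.left_commute)
  also have "\<dots> = (cmod c)\<^sup>2 * (x \<bullet> x)"
    by (simp add: inner_eq_Re_cinner flip: complex_norm_square)
  finally have "(norm (c *\<^sub>C x))\<^sup>2 = (cmod c * norm x)\<^sup>2"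
    by (simp add: power2_norm_eq_inner power_mult_distrib)
  then show ?thesis by simp
qed

lemma bounded_linear_scaleC: "bounded_linear ((*\<^sub>C) c :: 'a::complex_inner \<Rightarrow> 'a)"
proof (rule bounded_linear_intro[where K = "cmod c"])
  show "c *\<^sub>C (r *\<^sub>R x) = r *\<^sub>R (c *\<^sub>C x)" for r and x :: 'a
    by (simp add: scaleC_scaleR mult.commute scaleC_scaleC flip: scaleC_of_real)
qed (auto simp: scaleC_add_right norm_scaleC)

lemma affine_equation_on_line:
  assumes "complex_line L" "(0, 0) \<notin> L"
  obtains a b where "\<And>z w. (z, w) \<in> L \<Longrightarrow> a * z + b * w = 1"
proof -
  obtain p1 p2 v1 v2 where v: "(v1, v2) \<noteq> (0, 0)"
    and L: "L = range (\<lambda>t. (p1 + t * v1, p2 + t * v2))"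
    using assms(1) unfolding complex_line_def by blast
  define D where "D = p1 * v2 - p2 * v1"
  have "D \<noteq> 0"
  proof
    assume D: "D = 0"
    \<comment> \<open>If D = 0 the base point is a multiple of the direction; this parameter reaches the origin.\<close>
    define t where "t = (if v1 = 0 then - p2 / v2 else - p1 / v1)"
    have "p1 + t * v1 = 0" "p2 + t * v2 = 0"
      using D v by (auto simp: D_def t_def field_simps)
    then have "(0, 0) \<in> L" unfolding L by (metis (mono_tags, lifting) rangeI)
    with assms(2) show False by simp
  qed
  show ?thesis
  proof
    show "v2 / D * z + - v1 / D * w = 1" if "(z, w) \<in> L" for z w
    proof -
      have "z * v2 - w * v1 = D" using that by (auto simp: L D_def algebra_simps)
      then show ?thesis using \<open>D \<noteq> 0\<close> by (simp add: field_simps)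
    qed
  qed
qed

lemma complex_line_affine_equation:
  assumes "(a, b) \<noteq> (0, 0)"
  shows "complex_line {(z, w). 1 + a * z + b * w = 0}"
proof (cases "a = 0")
  case True
  then have b: "b \<noteq> 0" using assms by simp
  have "{(z, w). 1 + a * z + b * w = 0} = range (\<lambda>t. (0 + t * 1, - 1 / b + t * 0))"
    using b True by (auto simp: image_iff field_simps add_eq_0_iff)
  then show ?thesis unfolding complex_line_def by (metis prod.inject zero_neq_one)
next
  case False
  have "(z, w) \<in> range (\<lambda>t. (- 1 / a + t * (- b / a), 0 + t * 1))"
    if "1 + a * z + b * w = 0" for z w
  proof -
    have "a * z = - 1 - b * w" using that by (simp add: eq_diff_eq add_eq_0_iff algebra_simps)
    then have "z = - 1 / a + w * (- b / a)" using False by (simp add: field_simps)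
    then show ?thesis by (auto intro!: image_eqI[of _ _ w])
  qed
  then have "{(z, w). 1 + a * z + b * w = 0} = range (\<lambda>t. (- 1 / a + t * (- b / a), 0 + t * 1))"
    using False by (auto simp: field_simps)
  then show ?thesis unfolding complex_line_def by (metis prod.inject zero_neq_one)
qed

section \<open>Joint point spectra of compact symmetric pairs\<close>

text \<open>
  The scalars \<open>c\<close> and \<open>d\<close> make room for skew-adjoint operators. A line in the spectrum misses the
  origin, hence has an equation \<open>a * z + b * w = 1\<close>; substituting
  \<open>(z, w) = (-1/(m c), -t/(m d))\<close> and taking real parts turns it into an affine formula for the
  eigenvalues of the real pencil.
\<close>

lemma commute_of_spectrum_lines:
  fixes S T :: "'a::chilbert_space \<Rightarrow>\<^sub>L 'a"
  assumes P: "compact_selfadj P" and Q: "compact_selfadj Q"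
    and c: "c \<noteq> 0" and d: "d \<noteq> 0"
    and S: "\<And>x. S x = c *\<^sub>C P x" and T: "\<And>x. T x = d *\<^sub>C Q x"
    and lines: "locally_finite_union_of_lines (joint_point_spectrum S T)"
  shows "P (Q x) = Q (P x)"
proof -
  obtain \<L> where \<L>: "countable \<L>" "\<And>L. L \<in> \<L> \<Longrightarrow> complex_line L"
      "joint_point_spectrum S T = \<Union>\<L>"
    using lines unfolding locally_finite_union_of_lines_def by blast
  have "(0, 0) \<notin> joint_point_spectrum S T"
    by (simp add: joint_point_spectrum_def)
  then have "\<exists>a b. \<forall>z w. (z, w) \<in> L \<longrightarrow> a * z + b * w = 1" if "L \<in> \<L>" for L
    using affine_equation_on_line[OF \<L>(2)[OF that]] \<L>(3) that by (metis UnionI)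
  then obtain a b where ab: "\<And>L z w. L \<in> \<L> \<Longrightarrow> (z, w) \<in> L \<Longrightarrow> a L * z + b L * w = 1"
    by metis
  define F where "F = (\<lambda>L. (Re (- a L / c), Re (- b L / d))) ` \<L>"
  have "countable F" using \<L>(1) by (simp add: F_def)
  moreover have "pencil_eigenvalues_on P Q F"
    unfolding pencil_eigenvalues_on_def
  proof (intro allI impI)
    fix m t :: real and x
    assume m: "m \<noteq> 0" and x: "x \<noteq> 0" and eig: "P x + t *\<^sub>R Q x = m *\<^sub>R x"
    define z where "z = - 1 / (of_real m * c)"
    define w where "w = - of_real t / (of_real m * d)"
    have "x + z *\<^sub>C S x + w *\<^sub>C T x = x + (- of_real (1 / m)) *\<^sub>C (P x + t *\<^sub>R Q x)"
      using m c d by (simp add: S T z_def w_def scaleC_scaleC scaleC_add_right scaleC_scaleR)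
    also have "\<dots> = x + (of_real (- (1 / m) * m)) *\<^sub>C x"
      by (simp add: eig scaleC_scaleR)
    also have "\<dots> = 0" using m unfolding scaleC_of_real by simp
    finally have "(z, w) \<in> joint_point_spectrum S T"
      using x by (auto simp: joint_point_spectrum_def)
    then obtain L where L: "L \<in> \<L>" "(z, w) \<in> L" using \<L>(3) by blast
    from ab[OF this] have "of_real m = - a L / c + of_real t * (- b L / d)"
      using m c d by (simp add: z_def w_def field_simps)
    then have "m = Re (- a L / c + of_real t * (- b L / d))" by (metis Re_complex_of_real)
    also have "\<dots> = Re (- a L / c) + t * Re (- b L / d)"
      by (simp only: plus_complex.sel times_complex.sel Re_complex_of_real Im_complex_of_real mult_zero_left diff_zero)
    finally have "m = Re (- a L / c) + t * Re (- b L / d)" .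
    moreover have "(Re (- a L / c), Re (- b L / d)) \<in> F" using L(1) by (simp add: F_def)
    ultimately show "\<exists>(a, b)\<in>F. m = a + t * b" by blast
  qed
  ultimately show ?thesis by (rule commute_of_countable_pencil[OF P Q])
qed

text \<open>
  The kernel of \<open>I + z S + w T\<close> is invariant under the commuting operators \<open>P\<close> and \<open>Q\<close>. It
  contains an eigenvector of \<open>P\<close>, and the corresponding eigenspace within the kernel, being
  invariant under \<open>Q\<close>, contains an eigenvector of \<open>Q\<close>.
\<close>

lemma joint_spectrum_iff_joint_eigenvalue:
  fixes S T :: "'a::chilbert_space \<Rightarrow>\<^sub>L 'a"
  assumes P: "compact_selfadj P" and Q: "compact_selfadj Q"
    and PC: "\<And>k x. P (k *\<^sub>C x) = k *\<^sub>C P x" and QC: "\<And>k x. Q (k *\<^sub>C x) = k *\<^sub>C Q x"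
    and comm: "\<And>x. P (Q x) = Q (P x)"
    and S: "\<And>x. S x = c *\<^sub>C P x" and T: "\<And>x. T x = d *\<^sub>C Q x"
  shows "(z, w) \<in> joint_point_spectrum S T \<longleftrightarrow>
    (\<exists>l m x. x \<noteq> 0 \<and> P x = l *\<^sub>R x \<and> Q x = m *\<^sub>R x \<and>
      1 + c * of_real l * z + d * of_real m * w = 0)"
proof -
  interpret P: bounded_linear P by (rule compact_selfadjD(1)[OF P])
  interpret Q: bounded_linear Q by (rule compact_selfadjD(1)[OF Q])
  define R where "R x = x + (z * c) *\<^sub>C P x + (w * d) *\<^sub>C Q x" for x
  define K where "K = {x. R x = 0}"
  have R: "bounded_linear R"
    unfolding R_def
    by (intro bounded_linear_add bounded_linear_ident
        bounded_linear_compose[OF bounded_linear_scaleC P.bounded_linear_axioms]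
        bounded_linear_compose[OF bounded_linear_scaleC Q.bounded_linear_axioms])
  interpret R: bounded_linear R by (rule R)
  have spec: "(z, w) \<in> joint_point_spectrum S T \<longleftrightarrow> K \<noteq> {0}"
    by (simp add: joint_point_spectrum_def K_def R_def S T scaleC_scaleC)
  have joint: "R x = (1 + c * of_real l * z + d * of_real m * w) *\<^sub>C x"
    if "P x = l *\<^sub>R x" "Q x = m *\<^sub>R x" for l m x
    by (simp add: R_def that scaleC_scaleR scaleC_add_left mult_ac)
  have K: "subspace K"
    by (auto simp: K_def subspace_def R.add R.scaleR R.zero)
  have "closed K"
    unfolding K_def
    by (intro closed_Collect_eq linear_continuous_on[OF R] continuous_on_const)
  have "R (P x) = P (R x)" for x
    by (simp add: R_def P.add PC comm)
  then have KP: "P ` K \<subseteq> K" by (auto simp: K_def P.zero)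
  have "R (Q x) = Q (R x)" for x
    by (simp add: R_def Q.add QC comm)
  then have KQ: "Q ` K \<subseteq> K" by (auto simp: K_def Q.zero)
  show ?thesis
  proof
    assume "(z, w) \<in> joint_point_spectrum S T"
    then have "K \<noteq> {0}" using spec by simp
    from eigenvector_in_subspace[OF P K \<open>closed K\<close> this KP]
    obtain y l where y: "y \<in> K" "y \<noteq> 0" "P y = l *\<^sub>R y" by blast
    define E where "E = K \<inter> {x. P x = l *\<^sub>R x}"
    have E: "subspace E"
      unfolding E_def using K
      by (rule subspace_inter) (auto simp: subspace_def P.zero P.add P.scaleR algebra_simps)
    have "closed E"
      unfolding E_def using \<open>closed K\<close>
      by (intro closed_Int closed_Collect_eq linear_continuous_on[OF P.bounded_linear_axioms]
          continuous_intros)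
    moreover have "E \<noteq> {0}" using y by (auto simp: E_def)
    moreover have "Q ` E \<subseteq> E" using KQ by (auto simp: E_def comm Q.scaleR)
    ultimately obtain x m where x: "x \<in> E" "x \<noteq> 0" "Q x = m *\<^sub>R x"
      using eigenvector_in_subspace[OF Q E] by blast
    then have "P x = l *\<^sub>R x" "R x = 0" by (auto simp: E_def K_def)
    with x joint[of x l m] show "\<exists>l m x. x \<noteq> 0 \<and> P x = l *\<^sub>R x \<and> Q x = m *\<^sub>R x \<and>
        1 + c * of_real l * z + d * of_real m * w = 0"
      by auto
  next
    assume "\<exists>l m x. x \<noteq> 0 \<and> P x = l *\<^sub>R x \<and> Q x = m *\<^sub>R x \<and>
        1 + c * of_real l * z + d * of_real m * w = 0"
    then obtain l m x where "x \<noteq> 0" "P x = l *\<^sub>R x" "Q x = m *\<^sub>R x"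
        "1 + c * of_real l * z + d * of_real m * w = 0"
      by blast
    then have "x \<in> K" "x \<noteq> 0" using joint[of x l m] by (auto simp: K_def)
    then show "(z, w) \<in> joint_point_spectrum S T" using spec by blast
  qed
qed

text \<open>
  The lines are those of the nonzero joint eigenvalues. A line that comes within a bounded distance
  of the origin has a joint eigenvalue bounded away from zero, and there are only finitely many of
  these; this gives local finiteness, and countability by letting the bound tend to zero.
\<close>

lemma spectrum_lines_of_commute:
  fixes S T :: "'a::chilbert_space \<Rightarrow>\<^sub>L 'a"
  assumes P: "compact_selfadj P" and Q: "compact_selfadj Q"
    and PC: "\<And>k x. P (k *\<^sub>C x) = k *\<^sub>C P x" and QC: "\<And>k x. Q (k *\<^sub>C x) = k *\<^sub>C Q x"
    and comm: "\<And>x. P (Q x) = Q (P x)"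
    and c: "c \<noteq> 0" and d: "d \<noteq> 0"
    and S: "\<And>x. S x = c *\<^sub>C P x" and T: "\<And>x. T x = d *\<^sub>C Q x"
  shows "locally_finite_union_of_lines (joint_point_spectrum S T)"
proof -
  define J where "J = {(l, m). (l, m) \<noteq> (0, 0) \<and> (\<exists>x\<noteq>0. P x = l *\<^sub>R x \<and> Q x = m *\<^sub>R x)}"
  define line where "line = (\<lambda>(l, m). {(z, w). 1 + c * of_real l * z + d * of_real m * w = 0})"
  define big where "big r = {(l, m) \<in> J. r \<le> \<bar>l\<bar> \<or> r \<le> \<bar>m\<bar>}" for r
  have fin: "finite (big r)" if r: "r > 0" for r
  proof -
    let ?A = "{(l, m). r \<le> \<bar>l\<bar> \<and> (\<exists>x\<noteq>0. P x = l *\<^sub>R x \<and> Q x = m *\<^sub>R x)}"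
    let ?B = "{(m, l). r \<le> \<bar>m\<bar> \<and> (\<exists>x\<noteq>0. Q x = m *\<^sub>R x \<and> P x = l *\<^sub>R x)}"
    have "finite (?A \<union> prod.swap ` ?B)"
      using finite_large_joint_eigenvalues[OF P Q r] finite_large_joint_eigenvalues[OF Q P r] by blast
    moreover have "big r \<subseteq> ?A \<union> prod.swap ` ?B"
      by (auto simp: big_def J_def image_iff)
    ultimately show ?thesis by (rule finite_subset[rotated])
  qed
  have "J = (\<Union>n. big (1 / Suc n))"
  proof -
    have "\<exists>n. (l, m) \<in> big (1 / Suc n)" if "(l, m) \<in> J" for l m
    proof -
      have "max \<bar>l\<bar> \<bar>m\<bar> > 0" using that by (auto simp: J_def less_max_iff_disj)
      from reals_Archimedean[OF this] obtain n where "1 / real (Suc n) < max \<bar>l\<bar> \<bar>m\<bar>"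
        by (auto simp: inverse_eq_divide)
      then have "1 / real (Suc n) \<le> \<bar>l\<bar> \<or> 1 / real (Suc n) \<le> \<bar>m\<bar>" by linarith
      then have "(l, m) \<in> big (1 / Suc n)" unfolding big_def using that by simp
      then show ?thesis ..
    qed
    then have "p \<in> (\<Union>n. big (1 / Suc n))" if "p \<in> J" for p
      using that by (cases p) blast
    moreover have "big r \<subseteq> J" for r by (auto simp only: big_def)
    ultimately show ?thesis by (intro subset_antisym subsetI UN_least) (assumption, blast)
  qed
  then have "countable J"
    by (rule ssubst) (rule countable_UN[OF _ countable_finite[OF fin]]; simp)
  then have "countable (line ` J)" by simp
  moreover have "\<forall>L\<in>line ` J. complex_line L"
  proof
    fix L assume "L \<in> line ` J"
    then obtain l m where lm: "(l, m) \<in> J" "L = line (l, m)" by auto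
    then have "(c * of_real l, d * of_real m) \<noteq> (0, 0)" using c d by (auto simp: J_def)
    from complex_line_affine_equation[OF this] show "complex_line L" by (simp add: lm line_def)
  qed
  moreover have "locally_finite_in euclidean (line ` J)"
    unfolding locally_finite_in_def
  proof (intro conjI ballI)
    fix p :: "complex \<times> complex"
    \<comment> \<open>A line meeting the unit ball about p has a coordinate of its joint eigenvalue of size at least 1 / N.\<close>
    define N where "N = (norm p + 1) * (cmod c + cmod d)"
    have N: "N > 0" using c by (simp add: N_def add_nonneg_pos add_pos_nonneg)
    have "\<exists>i \<in> big (1 / (2 * N)). L = line i" if L: "L \<in> line ` J" "L \<inter> ball p 1 \<noteq> {}" for L
    proof -
      obtain l m where lm: "(l, m) \<in> J" "L = line (l, m)" using L(1) by auto
      obtain z w where zw: "(z, w) \<in> L" "(z, w) \<in> ball p 1" using L(2) by auto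
      have "norm (z, w) \<le> norm p + 1"
        using zw(2) norm_triangle_ineq2[of "(z, w)" p] by (simp add: dist_norm norm_minus_commute)
      then have bd: "cmod z \<le> norm p + 1" "cmod w \<le> norm p + 1"
        using norm_fst_le[of z w] norm_snd_le[of w z] by linarith+
      define h where "h = max \<bar>l\<bar> \<bar>m\<bar>"
      have "1 + (c * of_real l * z + d * of_real m * w) = 0"
        using zw(1) lm by (simp add: line_def add.assoc)
      from minus_unique[OF this] have "1 = cmod (c * of_real l * z + d * of_real m * w)"
        by (metis norm_minus_cancel norm_one)
      also have "\<dots> \<le> cmod c * \<bar>l\<bar> * cmod z + cmod d * \<bar>m\<bar> * cmod w"
        by (rule norm_triangle_le) (simp add: norm_mult)
      also have "\<dots> \<le> cmod c * h * (norm p + 1) + cmod d * h * (norm p + 1)"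
        by (intro add_mono mult_mono bd) (auto simp: h_def)
      also have "\<dots> = h * N" by (simp add: N_def algebra_simps)
      finally have "1 / N \<le> h" using N by (simp add: field_simps)
      moreover have "1 / (2 * N) \<le> 1 / N" using N by (simp add: field_simps)
      ultimately have "1 / (2 * N) \<le> h" by simp
      then have "(l, m) \<in> big (1 / (2 * N))"
        using lm by (auto simp: big_def h_def le_max_iff_disj)
      then show ?thesis using lm by blast
    qed
    then have "{L \<in> line ` J. L \<inter> ball p 1 \<noteq> {}} \<subseteq> line ` big (1 / (2 * N))" by blast
    moreover have "finite (line ` big (1 / (2 * N)))" using fin N by simp
    ultimately have "finite {L \<in> line ` J. L \<inter> ball p 1 \<noteq> {}}" by (rule finite_subset)
    then show "\<exists>V. openin euclidean V \<and> p \<in> V \<and> finite {U \<in> line ` J. U \<inter> V \<noteq> {}}"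
      by (intro exI[of _ "ball p 1"]) auto
  qed auto
  moreover have "joint_point_spectrum S T = \<Union> (line ` J)"
  proof -
    note spec = joint_spectrum_iff_joint_eigenvalue[OF P Q PC QC comm S T]
    have "(z, w) \<in> joint_point_spectrum S T \<longleftrightarrow> (z, w) \<in> \<Union> (line ` J)" for z w
    proof -
      have J: "(l, m) \<in> J \<longleftrightarrow> (\<exists>x\<noteq>0. P x = l *\<^sub>R x \<and> Q x = m *\<^sub>R x)"
        if "1 + c * of_real l * z + d * of_real m * w = 0" for l m
        using that unfolding J_def by auto
      have "(z, w) \<in> \<Union> (line ` J) \<longleftrightarrow>
          (\<exists>l m. (l, m) \<in> J \<and> 1 + c * of_real l * z + d * of_real m * w = 0)"
        unfolding line_def by blast
      also have "\<dots> \<longleftrightarrow> (z, w) \<in> joint_point_spectrum S T"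
        unfolding spec
      proof (intro iff_exI)
        fix l m
        show "((l, m) \<in> J \<and> 1 + c * of_real l * z + d * of_real m * w = 0) \<longleftrightarrow>
            (\<exists>x. x \<noteq> 0 \<and> P x = l *\<^sub>R x \<and> Q x = m *\<^sub>R x \<and>
              1 + c * of_real l * z + d * of_real m * w = 0)"
          using J[of l m] by auto
      qed
      finally show ?thesis ..
    qed
    then show ?thesis by (intro set_eqI) (metis surj_pair)
  qed
  ultimately show ?thesis unfolding locally_finite_union_of_lines_def by blast
qed

section \<open>Adjoints of compact operators\<close>

text \<open>
  The representing vector minimizes \<open>x \<bullet> x - 2 * f x\<close>. The parallelogram law makes minimizing
  sequences Cauchy, and the first-order condition at the minimum is the representation.
\<close>

lemma riesz_representation:
  fixes f :: "'a::{real_inner, banach} \<Rightarrow> real"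
  assumes "bounded_linear f"
  obtains y where "\<And>x. f x = x \<bullet> y"
proof -
  interpret f: bounded_linear f by (rule assms)
  define J where "J x = x \<bullet> x - 2 * f x" for x
  obtain K where K: "\<And>x. \<bar>f x\<bar> \<le> norm x * K" using f.bounded by auto
  have "- K\<^sup>2 \<le> J x" for x
  proof -
    have "0 \<le> (norm x - K)\<^sup>2" by simp
    also have "\<dots> = norm x * norm x - 2 * (norm x * K) + K\<^sup>2"
      by (simp add: power2_eq_square algebra_simps)
    finally show ?thesis
      using K[of x] by (simp add: J_def dot_square_norm power2_eq_square)
  qed
  then have bdd: "bdd_below (range J)" by (auto simp: bdd_below_def)
  define d where "d = Inf (range J)"
  have d: "d \<le> J x" for x unfolding d_def using bdd by (intro cInf_lower) auto
  have par: "J x + J y = 2 * J ((1/2) *\<^sub>R (x + y)) + (norm (x - y))\<^sup>2 / 2" for x y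
    by (simp add: J_def f.scaleR f.add power2_norm_eq_inner inner_add_left inner_add_right
        inner_diff_left inner_diff_right inner_commute field_simps)
  have "\<exists>x. J x < d + 1 / Suc n" for n
    using cInf_lessD[of "range J" "d + 1 / Suc n"] by (auto simp: d_def)
  then obtain u where u: "\<And>n. J (u n) < d + 1 / Suc n" by metis
  have close: "(norm (u m - u n))\<^sup>2 < 4 / Suc k" if "k \<le> m" "k \<le> n" for k m n
  proof -
    have "1 / real (Suc m) \<le> 1 / Suc k" "1 / real (Suc n) \<le> 1 / Suc k"
      using that by (auto intro!: divide_left_mono)
    then show ?thesis
      using u[of m] u[of n] d[of "(1/2) *\<^sub>R (u m + u n)"] par[of "u m" "u n"] by simp
  qed
  have "Cauchy u"
  proof (rule CauchyI)
    fix e :: real assume e: "e > 0"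
    then have "e\<^sup>2 / 4 > 0" by simp
    from reals_Archimedean[OF this] obtain k where "1 / real (Suc k) < e\<^sup>2 / 4"
      by (auto simp: inverse_eq_divide)
    then have k: "4 / real (Suc k) < e\<^sup>2" by simp
    have "norm (u m - u n) < e" if "k \<le> m" "k \<le> n" for m n
      using close[OF that] k e by (intro power_less_imp_less_base[of _ 2 e]) auto
    then show "\<exists>M. \<forall>m\<ge>M. \<forall>n\<ge>M. norm (u m - u n) < e" by blast
  qed
  then obtain y where y: "u \<longlonglongrightarrow> y" using Cauchy_convergent convergent_def by blast
  have "J y \<le> d"
  proof (rule LIMSEQ_le)
    show "(\<lambda>n. J (u n)) \<longlonglongrightarrow> J y"
      unfolding J_def by (intro tendsto_intros y f.tendsto)
    have "(\<lambda>n. d + 1 / Suc n) \<longlonglongrightarrow> d + 0"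
      by (intro tendsto_add tendsto_const) (rule LIMSEQ_Suc[OF lim_1_over_n])
    then show "(\<lambda>n. d + 1 / Suc n) \<longlonglongrightarrow> d" by simp
    show "\<exists>N. \<forall>n\<ge>N. J (u n) \<le> d + 1 / Suc n" using u less_imp_le by blast
  qed
  have "f x = x \<bullet> y" for x
  proof (cases "x = 0")
    case False
    define g where "g = x \<bullet> y - f x"
    \<comment> \<open>The minimum of the quadratic polynomial in s on the right-hand side below.\<close>
    define s where "s = - g / (x \<bullet> x)"
    have xx: "x \<bullet> x > 0" using False by simp
    have "J (y + s *\<^sub>R x) = J y + 2 * s * g + s\<^sup>2 * (x \<bullet> x)"
      by (simp add: J_def g_def f.add f.scaleR inner_add_left inner_add_right inner_commute
          power2_eq_square algebra_simps)
    also have "\<dots> = J y - g\<^sup>2 / (x \<bullet> x)"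
      using xx by (simp add: s_def power2_eq_square field_simps)
    finally have "g\<^sup>2 / (x \<bullet> x) \<le> 0" using \<open>J y \<le> d\<close> d[of "y + s *\<^sub>R x"] by simp
    then have "g\<^sup>2 \<le> 0" using xx by (simp add: divide_le_0_iff)
    then show ?thesis by (simp add: g_def)
  qed (simp add: f.zero)
  then show ?thesis by (rule that)
qed

lemma inner_eqI:
  fixes x y :: "'a::real_inner"
  assumes "\<And>z. z \<bullet> x = z \<bullet> y"
  shows "x = y"
proof -
  have "(x - y) \<bullet> (x - y) = 0" using assms[of "x - y"] by (simp add: inner_diff_right)
  then show ?thesis by simp
qed

text \<open>
  The real adjoint \<open>a\<close> of a complex linear map commutes with multiplication by \<open>\<i>\<close>, and is
  therefore also its Hermitian adjoint.
\<close>

lemma inner_adj: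
  fixes A :: "'a::chilbert_space \<Rightarrow>\<^sub>L 'a"
  assumes A: "complex_linear A"
  shows "A x \<bullet> y = x \<bullet> adj A y"
proof -
  have AC: "A (c *\<^sub>C x) = c *\<^sub>C A x" for c x using A by (simp add: complex_linear_def)
  have "\<exists>z. \<forall>x. A x \<bullet> y = x \<bullet> z" for y
    using riesz_representation[of "\<lambda>x. A x \<bullet> y"]
    by (metis bounded_linear_compose[OF bounded_linear_inner_left blinfun.bounded_linear_right])
  then obtain a where a: "\<And>x y. A x \<bullet> y = x \<bullet> a y" by metis
  have "bounded_linear a"
  proof (rule bounded_linear_intro[where K = "norm A"])
    show "a (x + y) = a x + a y" for x y
      by (rule inner_eqI) (simp add: inner_add_right flip: a)
    show "a (r *\<^sub>R x) = r *\<^sub>R a x" for r x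
      by (rule inner_eqI) (simp flip: a)
    show "norm (a y) \<le> norm y * norm A" for y
    proof (cases "a y = 0")
      case False
      have "norm (a y) * norm (a y) = A (a y) \<bullet> y"
        by (simp add: a dot_square_norm power2_eq_square)
      also have "\<dots> \<le> norm (A (a y)) * norm y" by (rule norm_cauchy_schwarz)
      also have "\<dots> \<le> (norm A * norm (a y)) * norm y"
        by (intro mult_right_mono norm_blinfun) simp
      finally show ?thesis using False by (simp add: mult_ac)
    qed simp
  qed
  then have a': "blinfun_apply (Blinfun a) = a" by (rule bounded_linear_Blinfun_apply)
  have ac: "a (\<i> *\<^sub>C y) = \<i> *\<^sub>C a y" for y
  proof (rule inner_eqI)
    fix z
    show "z \<bullet> a (\<i> *\<^sub>C y) = z \<bullet> (\<i> *\<^sub>C a y)"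
      by (simp add: inner_scaleC_right AC flip: a)
  qed
  have "adj A = Blinfun a"
    unfolding adj_def
  proof (rule the_equality)
    show "\<forall>x y. cinner (A x) y = cinner x (Blinfun a y)"
      by (simp add: a' cinner_eq_inner a ac)
    fix A' :: "'a \<Rightarrow>\<^sub>L 'a" assume A': "\<forall>x y. cinner (A x) y = cinner x (A' y)"
    show "A' = Blinfun a"
    proof (rule blinfun_eqI)
      fix y
      show "A' y = Blinfun a y"
        by (rule inner_eqI) (simp add: a' flip: a, simp add: inner_eq_Re_cinner A')
    qed
  qed
  then show ?thesis by (simp add: a a')
qed

lemma complex_linear_adj:
  fixes A :: "'a::chilbert_space \<Rightarrow>\<^sub>L 'a"
  assumes A: "complex_linear A"
  shows "adj A (c *\<^sub>C y) = c *\<^sub>C adj A y"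
proof (rule inner_eqI)
  fix z
  show "z \<bullet> adj A (c *\<^sub>C y) = z \<bullet> (c *\<^sub>C adj A y)"
    using A by (simp add: inner_scaleC_right complex_linear_def flip: inner_adj[OF A])
qed

lemma compact_operator_subseq:
  assumes A: "compact_operator A" and x: "bounded (range (x :: nat \<Rightarrow> 'a::chilbert_space))"
  obtains r where "strict_mono r" "convergent (\<lambda>n. A (x (r n)))"
proof -
  have "compact (closure (A ` range x))" using A x by (auto simp: compact_operator_def)
  moreover have "\<forall>n. A (x n) \<in> closure (A ` range x)"
    by (auto intro: closure_subset[THEN subsetD])
  ultimately obtain l r where "strict_mono r" "((\<lambda>n. A (x n)) \<circ> r) \<longlonglongrightarrow> l"
    using compact_imp_seq_compact seq_compactE by metis
  then show ?thesis by (intro that[of r]) (auto simp: convergent_def o_def)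
qed

text \<open>
  The adjoint of a compact operator is compact: along a subsequence the vectors \<open>A (adj A y)\<close>
  converge, and \<open>(norm (adj A u))\<^sup>2 = A (adj A u) \<bullet> u\<close> for the differences \<open>u\<close>.
\<close>

lemma adj_subseq:
  assumes A: "compact_operator A" and y: "bounded (range (y :: nat \<Rightarrow> 'a::chilbert_space))"
  obtains r where "strict_mono r" "convergent (\<lambda>n. adj A (y (r n)))"
proof -
  have Al: "complex_linear A" using A by (simp add: compact_operator_def)
  have "bounded (range (\<lambda>n. adj A (y n)))"
    using bounded_linear_image[OF y blinfun.bounded_linear_right[of "adj A"]] by (simp add: image_image)
  then obtain r where r: "strict_mono r" "convergent (\<lambda>n. A (adj A (y (r n))))"
    using compact_operator_subseq[OF A] by blast
  obtain C where C: "C > 0" "\<And>n. norm (y n) \<le> C"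
    using y unfolding bounded_pos by auto
  have "Cauchy (\<lambda>n. adj A (y (r n)))"
  proof (rule CauchyI)
    fix e :: real assume e: "e > 0"
    define z where "z n = adj A (y (r n))" for n
    have "e\<^sup>2 / (2 * C) > 0" using e C by simp
    from CauchyD[OF convergent_Cauchy[OF r(2)] this]
    obtain N where N: "\<And>i j. i \<ge> N \<Longrightarrow> j \<ge> N \<Longrightarrow> norm (A (z i) - A (z j)) < e\<^sup>2 / (2 * C)"
      unfolding z_def by blast
    have "norm (z i - z j) < e" if "i \<ge> N" "j \<ge> N" for i j
    proof -
      have "(norm (z i - z j))\<^sup>2 = (z i - z j) \<bullet> adj A (y (r i) - y (r j))"
        by (simp add: z_def power2_norm_eq_inner blinfun.diff_right)
      also have "\<dots> = (A (z i) - A (z j)) \<bullet> (y (r i) - y (r j))"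
        by (simp only: inner_adj[OF Al] flip: blinfun.diff_right)
      also have "\<dots> \<le> norm (A (z i) - A (z j)) * norm (y (r i) - y (r j))"
        by (rule norm_cauchy_schwarz)
      also have "\<dots> \<le> norm (A (z i) - A (z j)) * (2 * C)"
        using norm_triangle_ineq4[of "y (r i)" "y (r j)"] C(2)[of "r i"] C(2)[of "r j"]
        by (intro mult_left_mono) auto
      also have "\<dots> < e\<^sup>2" using N[OF that] C(1) by (simp add: field_simps)
      finally show ?thesis using e by (intro power_less_imp_less_base[of _ 2 e]) auto
    qed
    then show "\<exists>M. \<forall>m\<ge>M. \<forall>n\<ge>M. norm (adj A (y (r m)) - adj A (y (r n))) < e"
      unfolding z_def by blast
  qed
  then show ?thesis using that r(1) Cauchy_convergent by blast
qed

text \<open>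
  This is twice the real part of \<open>k A\<close>. For \<open>k = 1\<close> it is the sum of \<open>A\<close> and its adjoint; for
  \<open>k = \<i>\<close> it is \<open>\<i>\<close> times the difference.
\<close>

lemma compact_selfadj_real_part:
  fixes A :: "'a::chilbert_space \<Rightarrow>\<^sub>L 'a"
  assumes comp: "compact_operator A" and S: "\<And>x. S x = k *\<^sub>C A x + cnj k *\<^sub>C adj A x"
  shows "compact_selfadj S"
  unfolding compact_selfadj_def
proof (intro conjI allI impI)
  have A: "complex_linear A" using comp by (simp add: compact_operator_def)
  have move: "(c *\<^sub>C u) \<bullet> v = u \<bullet> (cnj c *\<^sub>C v)" for c and u v :: 'a
    by (simp add: inner_scaleC_right)
  have adjC: "adj A (c *\<^sub>C x) = c *\<^sub>C adj A x" "A (c *\<^sub>C x) = c *\<^sub>C A x" for c x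
    using complex_linear_adj[OF A] A by (auto simp: complex_linear_def)
  have S': "S = (\<lambda>x. k *\<^sub>C A x + cnj k *\<^sub>C adj A x)" using S by blast
  show "bounded_linear S"
    unfolding S'
    by (intro bounded_linear_add bounded_linear_compose[OF bounded_linear_scaleC]
        blinfun.bounded_linear_right)
  show "S x \<bullet> y = x \<bullet> S y" for x y
  proof -
    have "(k *\<^sub>C A x) \<bullet> y = x \<bullet> (cnj k *\<^sub>C adj A y)"
      by (simp add: move inner_adj[OF A] adjC)
    moreover have "(cnj k *\<^sub>C adj A x) \<bullet> y = x \<bullet> (k *\<^sub>C A y)"
      by (metis move adjC(2) complex_cnj_cnj inner_adj[OF A] inner_commute)
    ultimately show ?thesis by (simp add: S inner_add_left inner_add_right)
  qed
  fix x :: "nat \<Rightarrow> 'a" assume x: "bounded (range x)"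
  obtain r where r: "strict_mono r" "convergent (\<lambda>n. A (x (r n)))"
    using compact_operator_subseq[OF comp x] by blast
  have "bounded (range (\<lambda>n. x (r n)))"
    using x by (rule bounded_subset) auto
  then obtain q where q: "strict_mono q" "convergent (\<lambda>n. adj A (x (r (q n))))"
    using adj_subseq[OF comp] by blast
  have "convergent (\<lambda>n. A (x (r (q n))))"
    using convergent_subseq_convergent[OF r(2) q(1)] by (simp add: o_def)
  then obtain a b where "(\<lambda>n. A (x (r (q n)))) \<longlonglongrightarrow> a" "(\<lambda>n. adj A (x (r (q n)))) \<longlonglongrightarrow> b"
    using q(2) by (auto simp: convergent_def)
  then have "(\<lambda>n. S (x (r (q n)))) \<longlonglongrightarrow> k *\<^sub>C a + cnj k *\<^sub>C b"
    unfolding S by (intro tendsto_add bounded_linear.tendsto[OF bounded_linear_scaleC])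
  then show "\<exists>r. strict_mono r \<and> convergent (\<lambda>n. S (x (r n)))"
    using strict_mono_o[OF r(1) q(1)]
    by (intro exI[of _ "r \<circ> q"]) (auto simp: o_def convergent_def)
qed

section \<open>Complete commutation\<close>

lemma blinfun_commute_iff:
  "S o\<^sub>L T = T o\<^sub>L S \<longleftrightarrow> (\<forall>x. S (T x) = T (S x))"
  by (metis blinfun_apply_blinfun_compose blinfun_eqI)

lemma spectrum_lines_iff_commute:
  fixes A B S T :: "'a::chilbert_space \<Rightarrow>\<^sub>L 'a"
  assumes A: "compact_operator A" and B: "compact_operator B" and cd: "c \<noteq> 0" "d \<noteq> 0"
    and S: "\<And>x. S x = c *\<^sub>C (k *\<^sub>C A x + cnj k *\<^sub>C adj A x)"
    and T: "\<And>x. T x = d *\<^sub>C (l *\<^sub>C B x + cnj l *\<^sub>C adj B x)"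
  shows "locally_finite_union_of_lines (joint_point_spectrum S T) \<longleftrightarrow> S o\<^sub>L T = T o\<^sub>L S"
proof -
  define P where "P x = k *\<^sub>C A x + cnj k *\<^sub>C adj A x" for x
  define Q where "Q x = l *\<^sub>C B x + cnj l *\<^sub>C adj B x" for x
  have lin: "complex_linear A" "complex_linear B"
    using A B by (auto simp: compact_operator_def)
  have P: "compact_selfadj P" and Q: "compact_selfadj Q"
    using compact_selfadj_real_part[OF A P_def] compact_selfadj_real_part[OF B Q_def] by auto
  have PC: "P (z *\<^sub>C x) = z *\<^sub>C P x" and QC: "Q (z *\<^sub>C x) = z *\<^sub>C Q x" for z x
    using lin by (simp_all add: P_def Q_def complex_linear_def complex_linear_adj
        scaleC_add_right scaleC_scaleC mult.commute)
  note ST = S[folded P_def] T[folded Q_def]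
  have "S (T x) = T (S x) \<longleftrightarrow> P (Q x) = Q (P x)" for x
  proof -
    have "S (T x) - T (S x) = (c * d) *\<^sub>C (P (Q x) - Q (P x))"
      by (simp add: ST PC QC scaleC_scaleC scaleC_diff_right mult.commute)
    then show ?thesis using cd by (metis right_minus_eq mult_eq_0_iff scaleC_eq_0_iff)
  qed
  then have "S o\<^sub>L T = T o\<^sub>L S \<longleftrightarrow> (\<forall>x. P (Q x) = Q (P x))"
    unfolding blinfun_commute_iff by simp
  then show ?thesis
    using commute_of_spectrum_lines[OF P Q cd ST] spectrum_lines_of_commute[OF P Q PC QC _ cd ST]
    by blast
qed

text \<open>
  Taking adjoints of the two commutation relations shows that the adjoint of \<open>A\<close> also commutes
  with \<open>B\<close> and its adjoint, so all combinations commute. Conversely, \<open>2 A\<close>, \<open>2 B\<close> and twice the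
  adjoint of \<open>B\<close> are sums or differences of the operators on the right.
\<close>

lemma commute_completely_iff:
  fixes A B :: "'a::chilbert_space \<Rightarrow>\<^sub>L 'a"
  assumes A: "complex_linear A" and B: "complex_linear B"
  shows "commute_completely A B \<longleftrightarrow>
    (A + adj A) o\<^sub>L (B + adj B) = (B + adj B) o\<^sub>L (A + adj A) \<and>
    (A + adj A) o\<^sub>L (B - adj B) = (B - adj B) o\<^sub>L (A + adj A) \<and>
    (A - adj A) o\<^sub>L (B + adj B) = (B + adj B) o\<^sub>L (A - adj A) \<and>
    (A - adj A) o\<^sub>L (B - adj B) = (B - adj B) o\<^sub>L (A - adj A)"
    (is "_ \<longleftrightarrow> ?R")
proof
  assume cc: "commute_completely A B"
  then have 1: "A (B x) = B (A x)" and 2: "A (adj B x) = adj B (A x)" for x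
    unfolding commute_completely_def blinfun_commute_iff by auto
  have 3: "adj A (adj B x) = adj B (adj A x)" for x
    by (rule inner_eqI) (simp add: 1 flip: inner_adj[OF A] inner_adj[OF B])
  have 4: "adj A (B x) = B (adj A x)" for x
  proof (rule inner_eqI)
    fix z
    have "z \<bullet> adj A (B x) = x \<bullet> adj B (A z)"
      by (metis inner_adj[OF A] inner_adj[OF B] inner_commute)
    also have "\<dots> = z \<bullet> B (adj A x)"
      by (metis 2 inner_adj[OF A] inner_adj[OF B] inner_commute)
    finally show "z \<bullet> adj A (B x) = z \<bullet> B (adj A x)" .
  qed
  show ?R
    by (simp add: blinfun_commute_iff blinfun.add_left blinfun.diff_left blinfun.add_right
        blinfun.diff_right 1 2 3 4)
next
  assume R: ?R
  then have e: "(A + adj A) ((B + adj B) x) = (B + adj B) ((A + adj A) x)"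
    "(A + adj A) ((B - adj B) x) = (B - adj B) ((A + adj A) x)"
    "(A - adj A) ((B + adj B) x) = (B + adj B) ((A - adj A) x)"
    "(A - adj A) ((B - adj B) x) = (B - adj B) ((A - adj A) x)" for x
    unfolding blinfun_commute_iff by blast+
  note simps = blinfun.add_left blinfun.diff_left blinfun.add_right blinfun.diff_right
  have four: "4 *\<^sub>R v = v + v + v + v" for v :: 'a
    using scaleR_left_distrib[of 2 2 v] by (simp add: scaleR_2)
  have "4 *\<^sub>R A (B x) = 4 *\<^sub>R B (A x)" for x
  proof -
    have "4 *\<^sub>R A (B x) = (A + adj A) ((B + adj B) x) + (A + adj A) ((B - adj B) x)
        + (A - adj A) ((B + adj B) x) + (A - adj A) ((B - adj B) x)"
      by (simp add: simps four algebra_simps)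
    also have "\<dots> = 4 *\<^sub>R B (A x)"
      unfolding e by (simp add: simps four algebra_simps)
    finally show ?thesis .
  qed
  moreover have "4 *\<^sub>R A (adj B x) = 4 *\<^sub>R adj B (A x)" for x
  proof -
    have "4 *\<^sub>R A (adj B x) = (A + adj A) ((B + adj B) x) - (A + adj A) ((B - adj B) x)
        + (A - adj A) ((B + adj B) x) - (A - adj A) ((B - adj B) x)"
      by (simp add: simps four algebra_simps)
    also have "\<dots> = 4 *\<^sub>R adj B (A x)"
      unfolding e by (simp add: simps four algebra_simps)
    finally show ?thesis .
  qed
  ultimately show "commute_completely A B"
    by (simp add: commute_completely_def blinfun_commute_iff)
qed

theorem corollaryE:
  fixes A B :: "'a::chilbert_space \<Rightarrow>\<^sub>L 'a"
  assumes "compact_operator A" and "compact_operator B"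
    and "A + adj A \<noteq> 0 \<or> B + adj B \<noteq> 0"
    and "A + adj A \<noteq> 0 \<or> B - adj B \<noteq> 0"
    and "A - adj A \<noteq> 0 \<or> B + adj B \<noteq> 0"
    and "A - adj A \<noteq> 0 \<or> B - adj B \<noteq> 0"
  shows "commute_completely A B \<longleftrightarrow>
    locally_finite_union_of_lines (joint_point_spectrum (A + adj A) (B + adj B)) \<and>
    locally_finite_union_of_lines (joint_point_spectrum (A + adj A) (B - adj B)) \<and>
    locally_finite_union_of_lines (joint_point_spectrum (A - adj A) (B + adj B)) \<and>
    locally_finite_union_of_lines (joint_point_spectrum (A - adj A) (B - adj B))"
proof -
  have lin: "complex_linear A" "complex_linear B"
    using assms(1,2) by (auto simp: compact_operator_def)
  have p: "(X + adj X) x = 1 *\<^sub>C (1 *\<^sub>C X x + cnj 1 *\<^sub>C adj X x)" for X :: "'a \<Rightarrow>\<^sub>L 'a" and x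
    by (simp add: blinfun.add_left)
  have m: "(X - adj X) x = (- \<i>) *\<^sub>C (\<i> *\<^sub>C X x + cnj \<i> *\<^sub>C adj X x)" for X :: "'a \<Rightarrow>\<^sub>L 'a" and x
  proof -
    have "- 1 *\<^sub>C y = - y" for y :: 'a
      using scaleC_of_real[of "- 1" y] by simp
    then show ?thesis by (simp add: blinfun.diff_left scaleC_add_right scaleC_scaleC)
  qed
  \<comment> \<open>The sum is a symmetric operator itself (factor 1); the difference is - i times one.\<close>
  have 1: "(1 :: complex) \<noteq> 0" and i: "- \<i> \<noteq> 0" by auto
  note iff = spectrum_lines_iff_commute[OF assms(1,2)]
  show ?thesis
    unfolding iff[OF 1 1 p p] iff[OF 1 i p m] iff[OF i 1 m p] iff[OF i i m m]
    by (rule commute_completely_iff[OF lin])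
qed

end
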